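(* Let $\Delta\ge0$ be a fixed integer and let $0\le t,\tilde t<1$ be fixed. As $N_c\to\infty$ with $N_f=N_c+1+\Delta$, the unrefined Hilbert series of $U(N_c)$ SQCD with $N_f$ flavours satisfies $$g_{N_f,U(N_c)}(t,\tilde t)\sim\frac{1-\binom{N_f}{\Delta}^2(1-t\tilde t)^{2\Delta}(t\tilde t)^{N_c+1}}{(1-t\tilde t)^{N_f^2}}.$$
   Context: The unrefined Hilbert series of $U(N_c)$ SQCD with $N_f$ flavours is $$g_{N_f,U(N_c)}(t,\tilde t)=\frac{1}{N_c!(2\pi i)^{N_c}}\oint_{|z_1|=1}\frac{dz_1}{z_1}\cdots\oint_{|z_{N_c}|=1}\frac{dz_{N_c}}{z_{N_c}}\prod_{1\le a<b\le N_c}|z_a-z_b|^2\prod_{a=1}^{N_c}\frac{1}{(1-t/z_a)^{N_f}(1-\tilde t z_a)^{N_f}}.$$ The notation $A\sim B$ means that the ratio $A/B$ tends to $1$ in the stated limit. *)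

theory Defs
  imports "HOL-Complex_Analysis.Complex_Analysis" "HOL-Library.Landau_Symbols"
begin

text \<open>
  Since the number of integration variables is not fixed, the iterated integral
  is defined by recursion on it. The outermost variable is \<open>z 0\<close>, so that the
  variables are \<open>z 0, \<dots>, z (n - 1)\<close>; the values \<open>z k\<close> for \<open>k \<ge> n\<close> are irrelevant.
\<close>

primrec circle_integral :: "nat \<Rightarrow> ((nat \<Rightarrow> complex) \<Rightarrow> complex) \<Rightarrow> complex" where
  "circle_integral 0 F = F (\<lambda>_. 0)"
| "circle_integral (Suc n) F =
     contour_integral (circlepath 0 1)
       (\<lambda>w. circle_integral n (\<lambda>z. F (case_nat w z)) / w)"

definition sqcd_integrand ::
    "nat \<Rightarrow> nat \<Rightarrow> complex \<Rightarrow> complex \<Rightarrow> (nat \<Rightarrow> complex) \<Rightarrow> complex" where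
  "sqcd_integrand Nf Nc t t' z =
     (\<Prod>b<Nc. \<Prod>a<b. complex_of_real ((cmod (z a - z b))\<^sup>2)) *
     (\<Prod>a<Nc. 1 / ((1 - t / z a) ^ Nf * (1 - t' * z a) ^ Nf))"

definition sqcd_hilbert_series :: "nat \<Rightarrow> nat \<Rightarrow> complex \<Rightarrow> complex \<Rightarrow> complex" where
  "sqcd_hilbert_series Nf Nc t t' =
     1 / (fact Nc * (2 * complex_of_real pi * \<i>) ^ Nc) *
     circle_integral Nc (sqcd_integrand Nf Nc t t')"

end

(*
  Write q = t t', N = Nc, M = Nf = N + k with k = Delta + 1. On the torus |z_a - z_b|^2 is the
  product of the Vandermonde factors of z and of 1/z. Passing to the variables w = z / (1 - t' z)
  and w = (1/z) / (1 - t/z), the whole integrand becomes a product of two determinants with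
  entries z^I / (1 - t' z)^(I+1) and z^(-J) / (1 - t/z)^(J+1), k <= I, J < M. By Andreief's
  identity the Hilbert series is the determinant of the pairings

    S(I,J) = sum_m C(m,I) t'^(m-I) C(m,J) t^(m-J) = (1-q)^(-1-I-J) (P(t) P(t')^T)(I,J)

  where P(c) = (C(i,j) c^(i-j)) is a Pascal matrix, of determinant one and with inverse P(-c).
  The determinant is thus, up to a power of 1-q, the lower right N x N minor of P(t) P(t')^T.
  By Jacobi's identity this minor equals the upper left k x k minor of the inverse
  P(-t')^T P(-t), whose entries are the partial sums over m < M of the series S(i,j) at
  (-t, -t'). As k is fixed, the limit is the k x k determinant of S, which is a power of 1-q,
  and the powers of 1-q add up to (1-q)^(-M^2). Finally the correction term in the numerator of
  the asserted asymptotics tends to 0.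
*)

theory Submission
  imports Defs "Jordan_Normal_Form.Determinant"
begin

section \<open>Weighted binomial coefficients and their generating functions\<close>

text \<open>The truncated exponent is harmless: the binomial coefficient vanishes for \<open>i > m\<close>.\<close>

definition pascal :: "'a::comm_ring_1 \<Rightarrow> nat \<Rightarrow> nat \<Rightarrow> 'a" where
  "pascal c m i = of_nat (m choose i) * c ^ (m - i)"

lemma pascal_0 [simp]: "pascal c m 0 = c ^ m"
  by (simp add: pascal_def)

lemma pascal_0_left [simp]: "pascal c 0 i = (if i = 0 then 1 else 0)"
  by (simp add: pascal_def binomial_eq_0)

lemma pascal_diag [simp]: "pascal c i i = 1"
  by (simp add: pascal_def)

lemma pascal_eq_0: "m < i \<Longrightarrow> pascal c m i = 0"
  by (simp add: pascal_def binomial_eq_0)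

lemma pascal_Suc_Suc: "pascal c (Suc m) (Suc i) = c * pascal c m (Suc i) + pascal c m i"
proof (cases "Suc i \<le> m")
  case True
  then have "c ^ (m - i) = c * c ^ (m - Suc i)"
    by (metis Suc_diff_Suc Suc_le_lessD power_Suc)
  then show ?thesis
    by (simp add: pascal_def algebra_simps)
next
  case False
  then show ?thesis
    by (simp add: pascal_def binomial_eq_0)
qed

text \<open>This is the negative binomial series with exponent \<open>-(i + 1)\<close>, multiplied
  by \<open>x ^ i\<close>. The resulting index shift by \<open>i\<close> is undone because the terms
  with \<open>m < i\<close> vanish.\<close>

lemma pascal_sums:
  fixes c x :: complex
  assumes "norm (c * x) < 1"
  shows "(\<lambda>m. pascal c m i * x ^ m) sums (x ^ i / (1 - c * x) ^ Suc i)"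
proof -
  have nz: "1 - c * x \<noteq> 0"
    using assms by auto
  have "(\<lambda>n. (- of_nat (Suc i) gchoose n) * (- (c * x)) ^ n)
      sums (1 + - (c * x)) powr (- of_nat (Suc i))"
    by (rule gen_binomial_complex) (use assms in simp)
  moreover have "(- of_nat (Suc i) gchoose n) * (- (c * x)) ^ n
      = of_nat ((n + i) choose i) * (c * x) ^ n" for n
  proof -
    have "(- of_nat (Suc i) gchoose n :: complex)
        = (- 1) ^ n * (of_nat (n + i) gchoose n)"
      by (subst gbinomial_minus) (simp add: algebra_simps)
    also have "(of_nat (n + i) gchoose n :: complex) = of_nat ((n + i) choose i)"
      using binomial_symmetric[of n "n + i"] by (simp flip: binomial_gbinomial of_nat_add)
    moreover have "(- 1) ^ n * (- (c * x)) ^ n = (c * x) ^ n"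
      by (simp flip: power_mult_distrib)
    ultimately show ?thesis
      by (simp add: mult_ac)
  qed
  moreover have "(1 + - (c * x)) powr (- of_nat (Suc i)) = 1 / (1 - c * x) ^ Suc i"
    using powr_nat'[of "1 - c * x" "Suc i"] nz
    by (simp add: powr_minus_divide del: of_nat_Suc power_Suc)
  ultimately have "(\<lambda>n. of_nat ((n + i) choose i) * (c * x) ^ n) sums (1 / (1 - c * x) ^ Suc i)"
    by simp
  from sums_mult[OF this, of "x ^ i"]
  have "(\<lambda>n. pascal c (n + i) i * x ^ (n + i)) sums (x ^ i / (1 - c * x) ^ Suc i)"
    by (simp add: pascal_def power_add power_mult_distrib mult_ac)
  then show ?thesis
    by (subst (asm) sums_iff_shift) (simp add: pascal_eq_0)
qed

lemma summable_norm_pascal: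
  fixes c :: complex
  assumes "norm c < 1"
  shows "summable (\<lambda>m. norm (pascal c m i))"
proof -
  \<comment> \<open>The norms are entries of the same kind with \<open>c\<close> replaced by its
    norm, so the generating function at \<open>x = 1\<close> applies.\<close>
  have "summable (\<lambda>m. complex_of_real (norm (pascal c m i)))"
    using sums_summable[OF pascal_sums[of "of_real (norm c)" 1 i]] assms
    by (simp add: pascal_def norm_mult norm_power)
  then show ?thesis
    by (simp only: summable_of_real_iff)
qed

lemma summable_pascal_mult:
  fixes a b :: complex
  assumes "norm a < 1" "norm b < 1"
  shows "summable (\<lambda>m. norm (pascal a m i * pascal b m j))"
proof -
  have "(\<lambda>m. norm (pascal b m j)) \<longlonglongrightarrow> 0"
    using summable_LIMSEQ_zero[OF summable_norm_pascal[OF assms(2)]] .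
  then have "eventually (\<lambda>m. norm (pascal b m j) < 1) sequentially"
    by (rule order_tendstoD) simp
  then have "eventually (\<lambda>m. norm (norm (pascal a m i * pascal b m j)) \<le> norm (pascal a m i)) sequentially"
    by eventually_elim (simp add: norm_mult mult_left_le)
  then show ?thesis
    by (rule summable_comparison_test_ev) (rule summable_norm_pascal[OF assms(1)])
qed

section \<open>Gram products of Pascal matrices\<close>

text \<open>Entry \<open>(i, j)\<close> of P(b) P(a)^T. As P(b) is lower triangular, stopping at
  \<open>l = i\<close> loses nothing and makes the entry independent of the size of the
  matrices.\<close>

definition pascal_gram :: "'a::comm_ring_1 \<Rightarrow> 'a \<Rightarrow> nat \<Rightarrow> nat \<Rightarrow> 'a" where
  "pascal_gram b a i j = (\<Sum>l\<le>i. pascal b i l * pascal a j l)"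

lemma pascal_gram_conv:
  assumes "i < n"
  shows "pascal_gram b a i j = (\<Sum>l<n. pascal b i l * pascal a j l)"
  unfolding pascal_gram_def
  by (rule sum.mono_neutral_left) (use assms in \<open>auto simp: pascal_eq_0\<close>)

lemma pascal_gram_0 [simp]: "pascal_gram b a 0 j = a ^ j" "pascal_gram b a i 0 = b ^ i"
proof -
  show "pascal_gram b a 0 j = a ^ j"
    by (simp add: pascal_gram_def)
  have "pascal_gram b a i 0 = (\<Sum>l\<le>i. if l = 0 then b ^ i else 0)"
    unfolding pascal_gram_def by (rule sum.cong) auto
  then show "pascal_gram b a i 0 = b ^ i"
    by simp
qed

text \<open>Together with the values at index 0 this recurrence determines all entries. It has the
  shape that Pascal's rule forces on the series in \<open>pascal_mult_sums\<close> once the powers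
  of \<open>1 - a * b\<close> are cleared.\<close>

lemma pascal_gram_Suc_Suc:
  "pascal_gram b a (Suc i) (Suc j)
     = a * pascal_gram b a (Suc i) j + b * pascal_gram b a i (Suc j) + (1 - a * b) * pascal_gram b a i j"
proof -
  define n where "n = Suc i"
  define x where "x = pascal b i"
  define y where "y = pascal a j"
  note expand = pascal_gram_conv[of _ "Suc n"] sum.lessThan_Suc_shift pascal_Suc_Suc
  define P where "P = (\<Sum>l<n. x l * y l)"
  define Q where "Q = (\<Sum>l<n. x (Suc l) * y (Suc l))"
  define U where "U = (\<Sum>l<n. x (Suc l) * y l)"
  define V where "V = (\<Sum>l<n. x l * y (Suc l))"
  note defs = P_def Q_def U_def V_def
  have "pascal_gram b a (Suc i) (Suc j)
      = a * b * x 0 * y 0 + (\<Sum>l<n. (b * x (Suc l) + x l) * (a * y (Suc l) + y l))"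
    by (simp add: expand n_def x_def y_def del: sum.lessThan_Suc)
  also have "\<dots> = a * b * x 0 * y 0 + a * b * Q + b * U + a * V + P"
    by (simp add: defs algebra_simps sum.distrib sum_distrib_left)
  finally have A: "pascal_gram b a (Suc i) (Suc j) = \<dots>" .
  have "pascal_gram b a (Suc i) j = b * x 0 * y 0 + (\<Sum>l<n. (b * x (Suc l) + x l) * y (Suc l))"
    by (simp add: expand n_def x_def y_def del: sum.lessThan_Suc)
  also have "\<dots> = b * x 0 * y 0 + b * Q + V"
    by (simp add: defs algebra_simps sum.distrib sum_distrib_left)
  finally have B: "pascal_gram b a (Suc i) j = \<dots>" .
  have "pascal_gram b a i (Suc j) = a * x 0 * y 0 + (\<Sum>l<n. x (Suc l) * (a * y (Suc l) + y l))"
    by (simp add: expand n_def x_def y_def del: sum.lessThan_Suc)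
  also have "\<dots> = a * x 0 * y 0 + a * Q + U"
    by (simp add: defs algebra_simps sum.distrib sum_distrib_left)
  finally have C: "pascal_gram b a i (Suc j) = \<dots>" .
  have D: "pascal_gram b a i j = x 0 * y 0 + Q"
    by (simp add: expand n_def x_def y_def Q_def del: sum.lessThan_Suc)
  \<comment> \<open>Both \<open>n\<close> and \<open>Suc n\<close> exceed \<open>i\<close>, so
    summing the same entry over either range gives \<open>P\<close> and
    \<open>x 0 * y 0 + Q\<close>.\<close>
  have "pascal_gram b a i j = P"
    by (simp add: pascal_gram_conv[of _ n] n_def x_def y_def P_def)
  with D have E: "P = x 0 * y 0 + Q"
    by simp
  show ?thesis
    unfolding A B C D E by (simp add: algebra_simps)
qed

text \<open>Double induction. If one index is 0, the series is a single generating function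
  evaluated at the other parameter. Otherwise Pascal's rule in both factors expresses the sum
  through itself, with coefficient \<open>a * b\<close>, and three sums with smaller indices;
  solving for it yields the recurrence of \<open>pascal_gram\<close>. The parameters trade places:
  \<open>a\<close> belongs to index \<open>i\<close> on the left, but to \<open>j\<close> in
  \<open>pascal_gram b a i j\<close>.\<close>

lemma pascal_mult_sums:
  fixes a b :: complex
  assumes a: "norm a < 1" and b: "norm b < 1"
  shows "(\<lambda>m. pascal a m i * pascal b m j) sums (pascal_gram b a i j / (1 - a * b) ^ Suc (i + j))"
proof (induction i arbitrary: j)
  have ab: "norm (a * b) < 1"
    unfolding norm_mult using mult_strict_mono[OF a b] by simp
  then have nz: "1 - a * b \<noteq> 0"
    by auto
  case 0
  show ?case
    using pascal_sums[of b a j] ab by (simp add: mult_ac)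
  case (Suc i)
  show ?case
  proof (induction j)
    case 0
    show ?case
      using pascal_sums[of a b "Suc i"] ab by (simp add: mult_ac)
  next
    case (Suc j)
    define f where "f m = pascal a m (Suc i) * pascal b m (Suc j)" for m
    have "summable f"
      unfolding f_def by (rule summable_norm_cancel[OF summable_pascal_mult[OF a b]])
    then have s: "f sums suminf f"
      by (rule summable_sums)
    \<comment> \<open>The term at \<open>m = 0\<close> is zero since both lower indices are
      positive, so shifting the series keeps its sum.\<close>
    have "(\<lambda>m. f (Suc m)) sums suminf f"
      using s by (subst sums_Suc_iff) (simp add: f_def)
    moreover have "f (Suc m) = a * b * f m + a * (pascal a m (Suc i) * pascal b m j)
        + b * (pascal a m i * pascal b m (Suc j)) + pascal a m i * pascal b m j" for m
      by (simp add: f_def pascal_Suc_Suc algebra_simps)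
    ultimately have "(\<lambda>m. a * b * f m + a * (pascal a m (Suc i) * pascal b m j)
        + b * (pascal a m i * pascal b m (Suc j)) + pascal a m i * pascal b m j) sums suminf f"
      by simp
    moreover have "(\<lambda>m. a * b * f m + a * (pascal a m (Suc i) * pascal b m j)
        + b * (pascal a m i * pascal b m (Suc j)) + pascal a m i * pascal b m j) sums
        (a * b * suminf f + a * (pascal_gram b a (Suc i) j / (1 - a * b) ^ Suc (Suc i + j))
          + b * (pascal_gram b a i (Suc j) / (1 - a * b) ^ Suc (i + Suc j))
          + pascal_gram b a i j / (1 - a * b) ^ Suc (i + j))"
      by (intro sums_add sums_mult s Suc.IH \<open>\<And>j. (\<lambda>m. pascal a m i * pascal b m j) sums _ j\<close>)
    ultimately have "suminf f = a * b * suminf f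
          + a * (pascal_gram b a (Suc i) j / (1 - a * b) ^ Suc (Suc i + j))
          + b * (pascal_gram b a i (Suc j) / (1 - a * b) ^ Suc (i + Suc j))
          + pascal_gram b a i j / (1 - a * b) ^ Suc (i + j)"
      by (rule sums_unique2)
    moreover define d where "d = 1 - a * b"
    ultimately have "suminf f - a * b * suminf f
        = a * (pascal_gram b a (Suc i) j / d ^ Suc (Suc i + j))
          + b * (pascal_gram b a i (Suc j) / d ^ Suc (i + Suc j))
          + pascal_gram b a i j / d ^ Suc (i + j)"
      unfolding diff_eq_eq by (simp only: add_ac)
    moreover have "d * suminf f = suminf f - a * b * suminf f"
      by (simp add: d_def left_diff_distrib)
    ultimately have "d * suminf f = (a * pascal_gram b a (Suc i) j + b * pascal_gram b a i (Suc j)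
        + d * pascal_gram b a i j) / d ^ Suc (Suc (i + j))"
      using nz unfolding d_def[symmetric] by (simp add: add_divide_distrib)
    then have "suminf f = pascal_gram b a (Suc i) (Suc j) / (1 - a * b) ^ Suc (Suc i + Suc j)"
      using nz unfolding pascal_gram_Suc_Suc d_def[symmetric]
      by (simp add: nonzero_eq_divide_eq mult_ac)
    then show ?case
      using s unfolding f_def by simp
  qed
qed

section \<open>Pairings of generating functions on the unit circle\<close>

lemma circlepath_sums:
  assumes "\<And>m. continuous_on (sphere 0 1) (f m)"
    and "\<And>m z. z \<in> sphere 0 1 \<Longrightarrow> norm (f m z) \<le> B m" and "summable B"
  shows "(\<lambda>m. contour_integral (circlepath 0 1) (f m)) sums
    contour_integral (circlepath 0 1) (\<lambda>z. \<Sum>m. f m z)"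
proof -
  have int: "f m contour_integrable_on circlepath 0 1" for m
    by (rule contour_integrable_continuous_circlepath) (use assms(1) in simp)
  have "(\<lambda>n. contour_integral (circlepath 0 1) (\<lambda>z. \<Sum>m<n. f m z)) \<longlonglongrightarrow>
      contour_integral (circlepath 0 1) (\<lambda>z. \<Sum>m. f m z)"
    by (rule contour_integral_uniform_limit_circlepath)
      (auto intro!: always_eventually allI contour_integrable_sum int
        Weierstrass_m_test[OF assms(2,3)])
  then show ?thesis
    by (simp add: sums_def contour_integral_sum int)
qed

text \<open>Closed form of the generating function of column \<open>i\<close>. It is 1 / (1 - c x)
  times the \<open>i\<close>-th power of x / (1 - c x), which makes determinants of these functions
  Vandermonde determinants in the variable x / (1 - c x).\<close>

definition pascal_gf :: "complex \<Rightarrow> nat \<Rightarrow> complex \<Rightarrow> complex" where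
  "pascal_gf c i x = x ^ i / (1 - c * x) ^ Suc i"

lemma one_minus_mult_neq_0:
  fixes c x :: complex
  assumes "norm c < 1" "norm x = 1"
  shows "1 - c * x \<noteq> 0"
proof
  assume "1 - c * x = 0"
  then have "norm (c * x) = 1"
    by simp
  with assms show False
    by (simp add: norm_mult)
qed

lemma pascal_gf_suminf:
  assumes "norm c < 1" "norm x = 1"
  shows "pascal_gf c i x = (\<Sum>m. pascal c m i * x ^ m)"
  using pascal_sums[of c x i] assms unfolding pascal_gf_def norm_mult by (simp add: sums_iff)

lemma continuous_on_pascal_gf [continuous_intros]:
  assumes "norm c < 1" and "continuous_on A f" and "\<And>x. x \<in> A \<Longrightarrow> norm (f x) = 1"
  shows "continuous_on A (\<lambda>x. pascal_gf c i (f x))"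
  unfolding pascal_gf_def
  by (intro continuous_intros assms) (use assms one_minus_mult_neq_0 in auto)

text \<open>Orthogonality of monomials, read off from Cauchy's formula for the \<open>n\<close>-th
  derivative of \<open>z ^ m\<close> at 0.\<close>

lemma contour_integral_circlepath_monomial:
  "contour_integral (circlepath 0 1) (\<lambda>z. z ^ m * (1 / z) ^ n / z)
     = (if m = n then 2 * pi * \<i> else 0)"
proof -
  have "((\<lambda>z. z ^ m / (z - 0) ^ Suc n) has_contour_integral
      2 * pi * \<i> / fact n * (deriv ^^ n) (\<lambda>z. z ^ m) 0) (circlepath 0 1)"
    by (rule Cauchy_has_contour_integral_higher_derivative_circlepath)
      (auto intro!: continuous_intros holomorphic_intros)
  moreover have "(deriv ^^ n) (\<lambda>z. z ^ m) (0 :: complex) = (if m = n then fact n else 0)"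
    using higher_deriv_power[of n 0 m "0 :: complex"]
    by (auto simp: pochhammer_fact pochhammer_0_left power_0_left Suc_diff_le le_Suc_eq not_less)
  moreover have "(\<lambda>z::complex. z ^ m * (1 / z) ^ n / z) = (\<lambda>z. z ^ m / (z - 0) ^ Suc n)"
    by (auto simp: power_divide)
  ultimately show ?thesis
    by (simp only: contour_integral_unique) simp
qed

text \<open>Expanding one factor in powers of \<open>z\<close> and the other in powers of
  \<open>1 / z\<close>, orthogonality leaves the diagonal series of \<open>pascal_mult_sums\<close>.
  The factors are expanded one after the other, so that only single series are interchanged with the
  integral.\<close>

lemma contour_integral_pascal_gf:
  assumes a: "norm a < 1" and b: "norm b < 1"
  shows "contour_integral (circlepath 0 1) (\<lambda>z. pascal_gf a i z * pascal_gf b j (1 / z) / z)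
    = 2 * pi * \<i> * (pascal_gram b a i j / (1 - a * b) ^ Suc (i + j))"
proof -
  have nz: "z \<noteq> 0" if "z \<in> sphere 0 1" for z :: complex
    using that by auto
  define I where "I m = contour_integral (circlepath 0 1) (\<lambda>z. z ^ m * pascal_gf b j (1 / z) / z)" for m
  have I: "I m = 2 * pi * \<i> * pascal b m j" for m
  proof -
    have "(\<lambda>n. contour_integral (circlepath 0 1) (\<lambda>z. pascal b n j * (z ^ m * (1 / z) ^ n / z))) sums
        contour_integral (circlepath 0 1) (\<lambda>z. \<Sum>n. pascal b n j * (z ^ m * (1 / z) ^ n / z))"
      by (rule circlepath_sums[OF _ _ summable_norm_pascal[OF b, of j]])
        (auto intro!: continuous_intros simp: norm_mult norm_divide norm_power)
    also have "contour_integral (circlepath 0 1) (\<lambda>z. \<Sum>n. pascal b n j * (z ^ m * (1 / z) ^ n / z)) = I m"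
      unfolding I_def
    proof (rule contour_integral_eq)
      fix z :: complex
      assume "z \<in> path_image (circlepath 0 1)"
      then have z: "norm (1 / z) = 1"
        by (simp add: norm_divide)
      have "summable (\<lambda>n. pascal b n j * (1 / z) ^ n)"
        using pascal_sums[of b "1 / z" j] b z by (simp add: norm_divide sums_iff)
      from suminf_mult2[OF this, of "z ^ m / z"]
      show "(\<Sum>n. pascal b n j * (z ^ m * (1 / z) ^ n / z)) = z ^ m * pascal_gf b j (1 / z) / z"
        unfolding pascal_gf_suminf[OF b z] by (simp add: mult_ac)
    qed
    also have "(\<lambda>n. contour_integral (circlepath 0 1) (\<lambda>z. pascal b n j * (z ^ m * (1 / z) ^ n / z)))
        = (\<lambda>n. if n = m then 2 * pi * \<i> * pascal b m j else 0)"
    proof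
      fix n
      have "(\<lambda>z::complex. z ^ m * (1 / z) ^ n / z) contour_integrable_on circlepath 0 1"
        by (rule contour_integrable_continuous_circlepath) (auto intro!: continuous_intros)
      from contour_integral_lmul[OF this, of "pascal b n j"]
      show "contour_integral (circlepath 0 1) (\<lambda>z. pascal b n j * (z ^ m * (1 / z) ^ n / z))
          = (if n = m then 2 * pi * \<i> * pascal b m j else 0)"
        by (simp add: contour_integral_circlepath_monomial)
    qed
    finally show ?thesis
      using sums_single[of m "\<lambda>_. 2 * pi * \<i> * pascal b m j"] sums_unique2 by blast
  qed
  have cont: "continuous_on (sphere 0 1) (\<lambda>z. z ^ m * pascal_gf b j (1 / z) / z)" for m
    by (intro continuous_intros b) (auto simp: norm_divide)
  \<comment> \<open>By compactness the factor not yet expanded is bounded on the circle; this gives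
    the majorant for the second termwise integration.\<close>
  obtain K where K: "norm (pascal_gf b j (1 / z)) \<le> K" if "z \<in> sphere 0 1" for z
  proof -
    have "bounded ((\<lambda>z. pascal_gf b j (1 / z)) ` sphere 0 1)"
      by (intro compact_imp_bounded compact_continuous_image continuous_intros b)
        (auto simp: norm_divide)
    then show ?thesis
      using that unfolding bounded_iff by blast
  qed
  have "(\<lambda>m. contour_integral (circlepath 0 1) (\<lambda>z. pascal a m i * (z ^ m * pascal_gf b j (1 / z) / z))) sums
      contour_integral (circlepath 0 1) (\<lambda>z. \<Sum>m. pascal a m i * (z ^ m * pascal_gf b j (1 / z) / z))"
  proof (rule circlepath_sums)
    show "summable (\<lambda>m. norm (pascal a m i) * K)"
      by (intro summable_mult2 summable_norm_pascal a)
    show "norm (pascal a m i * (z ^ m * pascal_gf b j (1 / z) / z)) \<le> norm (pascal a m i) * K"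
      if "z \<in> sphere 0 1" for m z
      using that K[OF that] by (simp add: norm_mult norm_divide norm_power mult_left_mono)
  qed (intro continuous_on_mult_left cont)
  also have "contour_integral (circlepath 0 1) (\<lambda>z. \<Sum>m. pascal a m i * (z ^ m * pascal_gf b j (1 / z) / z))
      = contour_integral (circlepath 0 1) (\<lambda>z. pascal_gf a i z * pascal_gf b j (1 / z) / z)"
  proof (rule contour_integral_eq)
    fix z :: complex
    assume "z \<in> path_image (circlepath 0 1)"
    then have z: "norm z = 1"
      by simp
    have "summable (\<lambda>m. pascal a m i * z ^ m)"
      using pascal_sums[of a z i] a z by (simp add: norm_mult sums_iff)
    from suminf_mult2[OF this, of "pascal_gf b j (1 / z) / z"]
    show "(\<Sum>m. pascal a m i * (z ^ m * pascal_gf b j (1 / z) / z))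
        = pascal_gf a i z * pascal_gf b j (1 / z) / z"
      unfolding pascal_gf_suminf[OF a z] by (simp add: mult_ac)
  qed
  also have "(\<lambda>m. contour_integral (circlepath 0 1) (\<lambda>z. pascal a m i * (z ^ m * pascal_gf b j (1 / z) / z)))
      = (\<lambda>m. 2 * pi * \<i> * (pascal a m i * pascal b m j))"
  proof
    fix m
    have "(\<lambda>z. z ^ m * pascal_gf b j (1 / z) / z) contour_integrable_on circlepath 0 1"
      by (rule contour_integrable_continuous_circlepath) (use cont in simp)
    from contour_integral_lmul[OF this, of "pascal a m i"]
    show "contour_integral (circlepath 0 1) (\<lambda>z. pascal a m i * (z ^ m * pascal_gf b j (1 / z) / z))
        = 2 * pi * \<i> * (pascal a m i * pascal b m j)"
      using I[of m] by (simp add: I_def mult_ac)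
  qed
  finally show ?thesis
    using sums_mult[OF pascal_mult_sums[OF a b, of i j], of "2 * pi * \<i>"] sums_unique2 by blast
qed

section \<open>Iterated circle integrals\<close>

lemma circle_integral_cong:
  assumes "\<And>z. (\<And>a. a < n \<Longrightarrow> norm (z a) = 1) \<Longrightarrow> F z = G z"
  shows "circle_integral n F = circle_integral n G"
  using assms
proof (induction n arbitrary: F G)
  case 0
  then show ?case
    by simp
next
  case (Suc n)
  have "circle_integral n (\<lambda>z. F (case_nat w z)) = circle_integral n (\<lambda>z. G (case_nat w z))"
    if "norm w = 1" for w
    by (rule Suc.IH, rule Suc.prems) (use that in \<open>auto split: nat.split\<close>)
  then show ?case
    by (auto intro!: contour_integral_eq)
qed

text \<open>On finite sums of products of one-variable functions the iterated integral factorises by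
  linearity alone. The coefficients \<open>c\<close> and the dependence of \<open>g\<close> on
  \<open>a\<close> are what the induction needs.\<close>

lemma circle_integral_sum_prod:
  assumes "finite X" and "\<And>s a. s \<in> X \<Longrightarrow> continuous_on (sphere 0 1) (g s a)"
  shows "circle_integral n (\<lambda>z. \<Sum>s\<in>X. c s * (\<Prod>a<n. g s a (z a)))
    = (\<Sum>s\<in>X. c s * (\<Prod>a<n. contour_integral (circlepath 0 1) (\<lambda>w. g s a w / w)))"
  using assms(2)
proof (induction n arbitrary: c g)
  case 0
  then show ?case
    by simp
next
  case (Suc n)
  define J where "J s a = contour_integral (circlepath 0 1) (\<lambda>w. g s a w / w)" for s a
  \<comment> \<open>The factor in the outermost variable \<open>w\<close> is a constant for the
    inner integral and joins the coefficient; the other factors are reindexed by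
    \<open>Suc\<close>.\<close>
  have "circle_integral n (\<lambda>z. \<Sum>s\<in>X. c s * (\<Prod>a<Suc n. g s a (case_nat w z a)))
      = (\<Sum>s\<in>X. c s * g s 0 w * (\<Prod>a<n. J s (Suc a)))" for w
    unfolding J_def by (subst Suc.IH[symmetric])
      (use Suc.prems in \<open>auto simp: prod.lessThan_Suc_shift mult_ac simp del: prod.lessThan_Suc\<close>)
  then have "circle_integral (Suc n) (\<lambda>z. \<Sum>s\<in>X. c s * (\<Prod>a<Suc n. g s a (z a)))
      = contour_integral (circlepath 0 1) (\<lambda>w. \<Sum>s\<in>X. c s * (\<Prod>a<n. J s (Suc a)) * (g s 0 w / w))"
    by (simp add: sum_divide_distrib mult_ac)
  also have "\<dots> = (\<Sum>s\<in>X. c s * (\<Prod>a<n. J s (Suc a)) * J s 0)"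
  proof -
    have int: "(\<lambda>w. g s 0 w / w) contour_integrable_on circlepath 0 1" if "s \<in> X" for s
      by (rule contour_integrable_continuous_circlepath)
        (use Suc.prems[OF that, of 0] in \<open>auto intro!: continuous_intros\<close>)
    have "contour_integral (circlepath 0 1) (\<lambda>w. \<Sum>s\<in>X. c s * (\<Prod>a<n. J s (Suc a)) * (g s 0 w / w))
        = (\<Sum>s\<in>X. contour_integral (circlepath 0 1) (\<lambda>w. c s * (\<Prod>a<n. J s (Suc a)) * (g s 0 w / w)))"
      by (rule contour_integral_sum[OF \<open>finite X\<close> contour_integrable_lmul[OF int]])
    also have "\<dots> = (\<Sum>s\<in>X. c s * (\<Prod>a<n. J s (Suc a)) * J s 0)"
      by (rule sum.cong) (simp_all only: contour_integral_lmul[OF int] J_def)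
    finally show ?thesis .
  qed
  also have "\<dots> = (\<Sum>s\<in>X. c s * (\<Prod>a<Suc n. J s a))"
    by (simp add: prod.lessThan_Suc_shift mult_ac del: prod.lessThan_Suc)
  finally show ?case
    unfolding J_def .
qed

lemma det_leibniz:
  fixes B :: "nat \<Rightarrow> nat \<Rightarrow> 'a::comm_ring_1"
  shows "Determinant.det (Matrix.mat n n (\<lambda>(i, j). B i j))
    = (\<Sum>p | p permutes {0..<n}. of_int (sign p) * (\<Prod>i<n. B i (p i)))"
  using permutes_in_image[of _ "{0..<n}"]
  by (subst Determinant.det_def'[of _ n]) (auto simp: lessThan_atLeast0 intro!: sum.cong prod.cong)

text \<open>Both determinants are expanded over permutations \<open>p\<close> and \<open>r\<close>
  and integrated term by term. For fixed \<open>p\<close> the sum over \<open>r\<close> is the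
  determinant of the pairing matrix with its rows permuted by \<open>p\<close>; its sign cancels
  against that of \<open>p\<close>, leaving n! equal terms.\<close>

lemma andreief_identity:
  assumes u: "\<And>i. continuous_on (sphere 0 1) (u i)"
    and v: "\<And>i. continuous_on (sphere 0 1) (v i)"
  shows "circle_integral n (\<lambda>z. Determinant.det (Matrix.mat n n (\<lambda>(a, i). u i (z a))) *
      Determinant.det (Matrix.mat n n (\<lambda>(a, i). v i (z a))))
    = fact n * Determinant.det (Matrix.mat n n
        (\<lambda>(i, j). contour_integral (circlepath 0 1) (\<lambda>w. u i w * v j w / w)))"
proof -
  define S where "S = {p. p permutes {0..<n}}"
  define J where "J i j = contour_integral (circlepath 0 1) (\<lambda>w. u i w * v j w / w)" for i j
  have fin: "finite S"
    by (simp add: S_def finite_permutations)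
  have less: "p a < n" if "p \<in> S" "a < n" for p a
    using that permutes_in_image[of p "{0..<n}" a] by (simp add: S_def)
  have expand: "Determinant.det (Matrix.mat n n (\<lambda>(a, i). f a i))
      = (\<Sum>p\<in>S. of_int (sign p) * (\<Prod>a<n. f a (p a)))" for f :: "nat \<Rightarrow> nat \<Rightarrow> complex"
    unfolding S_def by (rule det_leibniz)
  have "circle_integral n (\<lambda>z. Determinant.det (Matrix.mat n n (\<lambda>(a, i). u i (z a))) *
      Determinant.det (Matrix.mat n n (\<lambda>(a, i). v i (z a))))
    = circle_integral n (\<lambda>z. \<Sum>s\<in>S \<times> S. (of_int (sign (fst s)) * of_int (sign (snd s))) *
        (\<Prod>a<n. u (fst s a) (z a) * v (snd s a) (z a)))"
    unfolding expand sum_product sum.cartesian_product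
    by (intro arg_cong[where f = "circle_integral n"] ext sum.cong refl)
      (auto simp: prod.distrib mult_ac)
  also have "\<dots> = (\<Sum>s\<in>S \<times> S. (of_int (sign (fst s)) * of_int (sign (snd s))) *
        (\<Prod>a<n. J (fst s a) (snd s a)))"
    unfolding J_def by (rule circle_integral_sum_prod) (auto intro!: continuous_intros u v fin)
  also have "\<dots> = (\<Sum>p\<in>S. of_int (sign p) *
      (\<Sum>r\<in>S. of_int (sign r) * (\<Prod>a<n. J (p a) (r a))))"
    by (simp add: sum.cartesian_product case_prod_unfold sum_distrib_left mult_ac)
  also have "\<dots> = (\<Sum>p\<in>S. Determinant.det (Matrix.mat n n (\<lambda>(i, j). J i j)))"
  proof (rule sum.cong)
    fix p
    assume p: "p \<in> S"
    have "(\<Sum>r\<in>S. of_int (sign r) * (\<Prod>a<n. J (p a) (r a)))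
        = Determinant.det (Matrix.mat n n (\<lambda>(a, j). J (p a) j))"
      by (rule expand[symmetric])
    also have "Matrix.mat n n (\<lambda>(a, j). J (p a) j)
        = Matrix.mat n n (\<lambda>(a, j). Matrix.mat n n (\<lambda>(i, j). J i j) $$ (p a, j))"
      by (rule Matrix.eq_matI) (auto simp: less[OF p])
    also have "Determinant.det \<dots>
        = of_int (sign p) * Determinant.det (Matrix.mat n n (\<lambda>(i, j). J i j))"
      by (rule Determinant.det_permute_rows) (use p in \<open>auto simp: S_def\<close>)
    finally show "of_int (sign p) * (\<Sum>r\<in>S. of_int (sign r) * (\<Prod>a<n. J (p a) (r a)))
        = Determinant.det (Matrix.mat n n (\<lambda>(i, j). J i j))"
      by (simp add: sign_def)
  qed simp
  also have "\<dots> = fact n * Determinant.det (Matrix.mat n n (\<lambda>(i, j). J i j))"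
    using card_permutations[of "{0..<n}" n] by (simp add: S_def)
  finally show ?thesis
    by (simp add: J_def)
qed

section \<open>Vandermonde determinants and the integrand\<close>

text \<open>The coefficients of \<open>X ^ i\<close> in the Newton basis with nodes \<open>x\<close>.\<close>

fun newton_coeff :: "(nat \<Rightarrow> 'a::comm_ring_1) \<Rightarrow> nat \<Rightarrow> nat \<Rightarrow> 'a" where
  "newton_coeff x 0 l = (if l = 0 then 1 else 0)"
| "newton_coeff x (Suc i) 0 = x 0 * newton_coeff x i 0"
| "newton_coeff x (Suc i) (Suc l) = newton_coeff x i l + x (Suc l) * newton_coeff x i (Suc l)"

lemma newton_coeff_eq_0: "i < l \<Longrightarrow> newton_coeff x i l = 0"
  by (induction x i l rule: newton_coeff.induct) auto

lemma newton_coeff_diag: "newton_coeff x i i = 1"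
  by (induction i) (auto simp: newton_coeff_eq_0)

lemma newton_expansion:
  "y ^ i = (\<Sum>l\<le>i. newton_coeff x i l * (\<Prod>m<l. y - x m))"
proof (induction i)
  case 0
  show ?case
    by simp
next
  case (Suc i)
  define N where "N l = (\<Prod>m<l. y - x m)" for l
  \<comment> \<open>Multiplication by \<open>y\<close> maps a Newton basis polynomial to the next
    one plus the node times itself.\<close>
  have N: "y * N l = N (Suc l) + x l * N l" for l
    by (simp add: N_def algebra_simps)
  have "(\<Sum>l\<le>Suc i. newton_coeff x (Suc i) l * N l)
      = (\<Sum>l\<le>i. newton_coeff x i l * N (Suc l)) + (x 0 * newton_coeff x i 0 * N 0
        + (\<Sum>l\<le>i. x (Suc l) * newton_coeff x i (Suc l) * N (Suc l)))"
    by (subst sum.atMost_Suc_shift) (simp add: algebra_simps sum.distrib)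
  also have "x 0 * newton_coeff x i 0 * N 0
        + (\<Sum>l\<le>i. x (Suc l) * newton_coeff x i (Suc l) * N (Suc l))
      = (\<Sum>l\<le>Suc i. x l * newton_coeff x i l * N l)"
    by (subst sum.atMost_Suc_shift) simp
  also have "\<dots> = (\<Sum>l\<le>i. x l * newton_coeff x i l * N l)"
    by (simp add: newton_coeff_eq_0)
  also have "(\<Sum>l\<le>i. newton_coeff x i l * N (Suc l)) + \<dots> = y * (\<Sum>l\<le>i. newton_coeff x i l * N l)"
    unfolding sum_distrib_left sum.distrib[symmetric]
    by (rule sum.cong[OF refl], subst mult.left_commute[of y], subst N) (simp add: algebra_simps)
  finally show ?case
    using Suc by (simp add: N_def)
qed

text \<open>Newton interpolation factorises the matrix without division. \<open>L\<close> holds the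
  Newton polynomials at the nodes and is lower triangular, because for \<open>l > a\<close> the
  factor with \<open>m = a\<close> vanishes; \<open>U\<close> holds the coefficients and is
  unitriangular.\<close>

lemma det_vandermonde:
  fixes x :: "nat \<Rightarrow> 'a::comm_ring_1"
  shows "Determinant.det (Matrix.mat n n (\<lambda>(a, i). x a ^ i)) = (\<Prod>b<n. \<Prod>a<b. x b - x a)"
proof -
  define L where "L = Matrix.mat n n (\<lambda>(a, l). \<Prod>m<l. x a - x m)"
  define U where "U = Matrix.mat n n (\<lambda>(l, i). newton_coeff x i l)"
  have carrier: "L \<in> carrier_mat n n" "U \<in> carrier_mat n n"
    by (simp_all add: L_def U_def)
  have "Matrix.mat n n (\<lambda>(a, i). x a ^ i) = L * U"
  proof (rule Matrix.eq_matI)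
    fix a i
    assume "a < dim_row (L * U)" "i < dim_col (L * U)"
    then have ai: "a < n" "i < n"
      by (simp_all add: L_def U_def)
    have "(L * U) $$ (a, i) = (\<Sum>l<n. (\<Prod>m<l. x a - x m) * newton_coeff x i l)"
      using ai by (simp add: L_def U_def scalar_prod_def lessThan_atLeast0)
    also have "\<dots> = (\<Sum>l\<le>i. (\<Prod>m<l. x a - x m) * newton_coeff x i l)"
      by (rule sum.mono_neutral_right) (use ai in \<open>auto simp: newton_coeff_eq_0\<close>)
    also have "\<dots> = x a ^ i"
      by (subst newton_expansion[of "x a" i x]) (simp add: mult_ac)
    finally show "Matrix.mat n n (\<lambda>(a, i). x a ^ i) $$ (a, i) = (L * U) $$ (a, i)"
      using ai by simp
  qed (simp_all add: L_def U_def)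
  moreover have "Determinant.det L = (\<Prod>b<n. \<Prod>a<b. x b - x a)"
  proof -
    have "Determinant.det L = prod_list (diag_mat L)"
      by (rule Determinant.det_lower_triangular[OF _ carrier(1)]) (auto simp: L_def intro!: prod_zero)
    then show ?thesis
      by (simp add: prod_list_diag_prod L_def lessThan_atLeast0)
  qed
  moreover have "Determinant.det U = 1"
  proof -
    have "Determinant.det U = prod_list (diag_mat U)"
      by (rule Determinant.det_upper_triangular[OF _ carrier(2)])
        (auto simp: U_def upper_triangular_def newton_coeff_eq_0)
    then show ?thesis
      by (simp add: prod_list_diag_prod U_def newton_coeff_diag)
  qed
  ultimately show ?thesis
    by (simp add: Determinant.det_mult[OF carrier])
qed

section \<open>From the integrand to a single determinant\<close>

lemma det_scale:
  fixes x y :: "nat \<Rightarrow> 'a::comm_ring_1"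
  shows "Determinant.det (Matrix.mat n n (\<lambda>(i, j). x i * A i j * y j))
    = (\<Prod>i<n. x i) * (\<Prod>i<n. y i) * Determinant.det (Matrix.mat n n (\<lambda>(i, j). A i j))"
proof -
  have "(\<Prod>i<n. x i * A i (p i) * y (p i)) = (\<Prod>i<n. x i) * (\<Prod>i<n. y i) * (\<Prod>i<n. A i (p i))"
    if "p permutes {0..<n}" for p
    using prod.permute[of p "{..<n}" y] that
    by (simp add: prod.distrib comp_def lessThan_atLeast0 mult_ac)
  then show ?thesis
    by (simp add: det_leibniz sum_distrib_left mult_ac)
qed

text \<open>Each index lies in exactly \<open>n - 1\<close> of the pairs.\<close>

lemma prod_pairs_mult:
  fixes y :: "nat \<Rightarrow> 'a::comm_monoid_mult"
  shows "(\<Prod>b<n. \<Prod>a<b. y a * y b) = (\<Prod>a<n. y a) ^ (n - 1)"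
proof (induction n)
  case (Suc n)
  define P where "P = (\<Prod>a<n. y a)"
  have "(\<Prod>a<n. y a * y n) = P * y n ^ n"
    by (simp add: prod.distrib P_def)
  then have "(\<Prod>b<Suc n. \<Prod>a<b. y a * y b) = P ^ (n - 1) * (P * y n ^ n)"
    using Suc by (simp only: prod.lessThan_Suc P_def)
  \<comment> \<open>For \<open>n = 0\<close> the exponent \<open>n - 1\<close> is truncated, but
    then \<open>P\<close> is an empty product.\<close>
  also have "\<dots> = (P * y n) ^ n"
    by (cases n) (simp_all add: P_def power_mult_distrib mult_ac)
  finally show ?case
    by (simp add: P_def)
qed simp

text \<open>For w = x / (1 - c x) the difference w_b - w_a equals (x_b - x_a) / ((1 - c x_a) (1 - c
  x_b)). The Vandermonde product in w thus contributes \<open>n - 1\<close> further denominators to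
  each variable, and the common row factor contributes \<open>k + 1\<close>, in total
  \<open>n + k\<close>.\<close>

lemma det_pascal_gf:
  assumes "\<And>a. a < n \<Longrightarrow> 1 - c * x a \<noteq> 0"
  shows "Determinant.det (Matrix.mat n n (\<lambda>(a, i). pascal_gf c (i + k) (x a)))
    = (\<Prod>b<n. \<Prod>a<b. x b - x a) * (\<Prod>a<n. x a ^ k / (1 - c * x a) ^ (n + k))"
proof (cases "n = 0")
  case True
  then show ?thesis
    by (simp add: Determinant.det_def)
next
  case False
  define y where "y a = 1 / (1 - c * x a)" for a
  have "Matrix.mat n n (\<lambda>(a, i). pascal_gf c (i + k) (x a))
      = Matrix.mat n n (\<lambda>(a, i). (x a ^ k * y a ^ Suc k) * (x a * y a) ^ i * 1)"
    by (rule Matrix.eq_matI)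
      (auto simp: pascal_gf_def y_def power_add power_divide power_mult_distrib mult_ac)
  then have "Determinant.det (Matrix.mat n n (\<lambda>(a, i). pascal_gf c (i + k) (x a)))
      = (\<Prod>a<n. x a ^ k * y a ^ Suc k) * (\<Prod>b<n. \<Prod>a<b. x b * y b - x a * y a)"
    by (simp only: det_scale det_vandermonde) simp
  also have "(\<Prod>b<n. \<Prod>a<b. x b * y b - x a * y a)
      = (\<Prod>b<n. \<Prod>a<b. (x b - x a) * (y a * y b))"
    using assms by (intro prod.cong refl) (auto simp: y_def divide_simps, auto simp: algebra_simps)
  also have "\<dots> = (\<Prod>b<n. \<Prod>a<b. x b - x a) * (\<Prod>a<n. y a ^ (n - 1))"
  proof -
    have "(\<Prod>a<b. (x b - x a) * (y a * y b)) = (\<Prod>a<b. x b - x a) * (\<Prod>a<b. y a * y b)" for b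
      by (rule prod.distrib)
    then show ?thesis
      by (simp only: prod.distrib[where g = "\<lambda>b. \<Prod>a<b. x b - x a"] prod_pairs_mult prod_power_distrib)
  qed
  finally have "Determinant.det (Matrix.mat n n (\<lambda>(a, i). pascal_gf c (i + k) (x a)))
      = (\<Prod>b<n. \<Prod>a<b. x b - x a) * (\<Prod>a<n. x a ^ k * y a ^ Suc k * y a ^ (n - 1))"
    by (simp add: prod.distrib mult_ac)
  also have "(\<lambda>a. x a ^ k * y a ^ Suc k * y a ^ (n - 1)) = (\<lambda>a. x a ^ k / (1 - c * x a) ^ (n + k))"
    using False by (cases n) (simp_all add: y_def power_divide power_add mult_ac)
  finally show ?thesis .
qed

text \<open>On the torus \<open>1 / z a\<close> is the conjugate of \<open>z a\<close>, so the two
  Vandermonde products multiply to the squared distances. The index shift \<open>k\<close> raises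
  the denominators to the power \<open>n + k\<close>, the number of flavours, and the monomials
  \<open>z a ^ k\<close> and \<open>(1 / z a) ^ k\<close> that it brings along cancel.\<close>

lemma sqcd_integrand_eq_det:
  assumes t: "norm t < 1" and t': "norm t' < 1" and z: "\<And>a. a < n \<Longrightarrow> norm (z a) = 1"
  shows "sqcd_integrand (n + k) n t t' z
    = Determinant.det (Matrix.mat n n (\<lambda>(a, i). pascal_gf t' (i + k) (z a)))
      * Determinant.det (Matrix.mat n n (\<lambda>(a, i). pascal_gf t (i + k) (1 / z a)))"
proof -
  have inv: "1 / z a = cnj (z a)" if "a < n" for a
    using z[OF that] by (metis complex_mod_cnj complex_norm_square mult.commute
      nonzero_eq_divide_eq norm_one of_real_1 one_power2 zero_neq_one norm_zero complex_cnj_zero_iff)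
  have nz: "z a \<noteq> 0" if "a < n" for a
    using z[OF that] by auto
  have "(\<Prod>b<n. \<Prod>a<b. z b - z a) * (\<Prod>b<n. \<Prod>a<b. 1 / z b - 1 / z a)
      = (\<Prod>b<n. \<Prod>a<b. (z b - z a) * (1 / z b - 1 / z a))"
    by (simp add: prod.distrib)
  also have "\<dots> = (\<Prod>b<n. \<Prod>a<b. complex_of_real ((cmod (z a - z b))\<^sup>2))"
  proof (intro prod.cong refl)
    fix a b
    assume "b \<in> {..<n}" "a \<in> {..<b}"
    then have "(z b - z a) * (1 / z b - 1 / z a) = (z b - z a) * cnj (z b - z a)"
      by (simp add: inv)
    then show "(z b - z a) * (1 / z b - 1 / z a) = complex_of_real ((cmod (z a - z b))\<^sup>2)"
      by (simp only: complex_norm_square[symmetric] norm_minus_commute)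
  qed
  finally have V: "(\<Prod>b<n. \<Prod>a<b. z b - z a) * (\<Prod>b<n. \<Prod>a<b. 1 / z b - 1 / z a) = \<dots>" .
  have "(\<Prod>a<n. z a ^ k / (1 - t' * z a) ^ (n + k)) * (\<Prod>a<n. (1 / z a) ^ k / (1 - t * (1 / z a)) ^ (n + k))
      = (\<Prod>a<n. 1 / ((1 - t / z a) ^ (n + k) * (1 - t' * z a) ^ (n + k)))"
    unfolding prod.distrib[symmetric]
    by (rule prod.cong) (use nz in \<open>auto simp: power_divide mult.commute\<close>)
  moreover have "Determinant.det (Matrix.mat n n (\<lambda>(a, i). pascal_gf t' (i + k) (z a)))
      = (\<Prod>b<n. \<Prod>a<b. z b - z a) * (\<Prod>a<n. z a ^ k / (1 - t' * z a) ^ (n + k))"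
    by (rule det_pascal_gf) (rule one_minus_mult_neq_0[OF t' z])
  moreover have "Determinant.det (Matrix.mat n n (\<lambda>(a, i). pascal_gf t (i + k) (1 / z a)))
      = (\<Prod>b<n. \<Prod>a<b. 1 / z b - 1 / z a) * (\<Prod>a<n. (1 / z a) ^ k / (1 - t * (1 / z a)) ^ (n + k))"
    by (rule det_pascal_gf) (rule one_minus_mult_neq_0[OF t], use z in \<open>simp add: norm_divide\<close>)
  ultimately show ?thesis
    unfolding sqcd_integrand_def V[symmetric] by (simp only: mult_ac)
qed

lemma sqcd_hilbert_series_eq_det:
  assumes t: "norm t < 1" and t': "norm t' < 1"
  shows "sqcd_hilbert_series (n + k) n t t' = Determinant.det (Matrix.mat n n
    (\<lambda>(i, j). pascal_gram t t' (i + k) (j + k) / (1 - t * t') ^ Suc (i + k + (j + k))))"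
proof -
  have cont: "continuous_on (sphere 0 1) (\<lambda>z. pascal_gf t' i z)"
    "continuous_on (sphere 0 1) (\<lambda>z. pascal_gf t i (1 / z))" for i
    by (intro continuous_intros t t'; auto simp: norm_divide)+
  have "circle_integral n (sqcd_integrand (n + k) n t t')
      = circle_integral n (\<lambda>z. Determinant.det (Matrix.mat n n (\<lambda>(a, i). pascal_gf t' (i + k) (z a)))
        * Determinant.det (Matrix.mat n n (\<lambda>(a, i). pascal_gf t (i + k) (1 / z a))))"
    by (rule circle_integral_cong) (rule sqcd_integrand_eq_det[OF t t'])
  also have "\<dots> = fact n * Determinant.det (Matrix.mat n n
        (\<lambda>(i, j). contour_integral (circlepath 0 1)
          (\<lambda>w. pascal_gf t' (i + k) w * pascal_gf t (j + k) (1 / w) / w)))"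
    by (rule andreief_identity) (rule cont)+
  \<comment> \<open>Every pairing carries a factor 2 pi i. Taken out of the determinant, these and
    the factorial cancel the normalisation of the Hilbert series.\<close>
  also have "\<dots> = fact n * Determinant.det ((2 * pi * \<i>) \<cdot>\<^sub>m Matrix.mat n n
    (\<lambda>(i, j). pascal_gram t t' (i + k) (j + k) / (1 - t * t') ^ Suc (i + k + (j + k))))"
    by (intro arg_cong[where f = "\<lambda>A. fact n * Determinant.det A"] Matrix.eq_matI)
      (auto simp: contour_integral_pascal_gf[OF t' t] mult_ac)
  finally show ?thesis
    by (simp add: sqcd_hilbert_series_def Determinant.det_smult)
qed

section \<open>Pascal matrices\<close>

definition pascal_mat :: "nat \<Rightarrow> 'a::comm_ring_1 \<Rightarrow> 'a mat" where
  "pascal_mat n c = Matrix.mat n n (\<lambda>(i, j). pascal c i j)"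

lemma pascal_mat_carrier [simp]: "pascal_mat n c \<in> carrier_mat n n"
  by (simp add: pascal_mat_def)

lemma det_pascal_mat: "Determinant.det (pascal_mat n c) = 1"
proof -
  have "Determinant.det (pascal_mat n c) = prod_list (diag_mat (pascal_mat n c))"
    by (rule Determinant.det_lower_triangular[OF _ pascal_mat_carrier])
      (simp add: pascal_mat_def pascal_eq_0)
  then show ?thesis
    by (simp add: prod_list_diag_prod pascal_mat_def)
qed

text \<open>Row \<open>i\<close> of P(c) lists the coefficients of (X + c)^i, so P(c) represents the
  substitution of X + c for X, and composing two substitutions adds their parameters.\<close>

lemma pascal_add:
  assumes "i < n"
  shows "(\<Sum>l<n. pascal a i l * pascal b l j) = pascal (a + b) i j"
  using assms
proof (induction i arbitrary: j n)
  case 0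
  have "(\<Sum>l<n. pascal a 0 l * pascal b l j) = (\<Sum>l<n. if l = 0 then pascal b l j else 0)"
    by (rule sum.cong) auto
  then show ?case
    using 0 by simp
next
  case (Suc i)
  obtain m where n: "n = Suc m" and m: "i < m"
    using Suc.prems by (cases n) auto
  have split: "(\<Sum>l<n. pascal a (Suc i) l * pascal b l j)
      = a * (\<Sum>l<n. pascal a i l * pascal b l j) + (\<Sum>l<m. pascal a i l * pascal b (Suc l) j)"
    unfolding n sum.lessThan_Suc_shift
    by (simp add: pascal_Suc_Suc algebra_simps sum.distrib sum_distrib_left)
  \<comment> \<open>Splitting off \<open>l = 0\<close> shortens one of the sums, so the induction
    hypothesis is needed for both ranges.\<close>
  have IH: "(\<Sum>l<n. pascal a i l * pascal b l j) = pascal (a + b) i j"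
    "(\<Sum>l<m. pascal a i l * pascal b l j) = pascal (a + b) i j" for j
    using m n by (simp_all only: Suc.IH less_SucI)
  show ?case
  proof (cases j)
    case 0
    then have "(\<Sum>l<m. pascal a i l * pascal b (Suc l) j) = b * (\<Sum>l<m. pascal a i l * pascal b l j)"
      by (simp add: sum_distrib_left mult_ac)
    then show ?thesis
      unfolding split IH using 0 by (simp add: algebra_simps)
  next
    case (Suc k)
    then have "(\<Sum>l<m. pascal a i l * pascal b (Suc l) j)
        = b * (\<Sum>l<m. pascal a i l * pascal b l j) + (\<Sum>l<m. pascal a i l * pascal b l k)"
      by (simp add: pascal_Suc_Suc algebra_simps sum.distrib sum_distrib_left)
    then show ?thesis
      unfolding split IH using Suc by (simp add: pascal_Suc_Suc algebra_simps)
  qed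
qed

lemma pascal_mat_mult: "pascal_mat n a * pascal_mat n b = pascal_mat n (a + b)"
  by (rule Matrix.eq_matI)
    (simp_all add: pascal_mat_def scalar_prod_def pascal_add flip: lessThan_atLeast0)

lemma pascal_mat_0: "pascal_mat n 0 = 1\<^sub>m n"
proof (rule Matrix.eq_matI)
  fix i j
  assume "i < dim_row (1\<^sub>m n)" "j < dim_col (1\<^sub>m n)"
  then show "pascal_mat n 0 $$ (i, j) = 1\<^sub>m n $$ (i, j)"
    by (cases i j rule: linorder_cases) (auto simp: pascal_mat_def pascal_def binomial_eq_0 power_0_left)
qed (simp_all add: pascal_mat_def)

section \<open>Trading the large minor for one of fixed size\<close>

text \<open>\<open>C\<close> is \<open>B\<close> with its last \<open>n\<close> columns replaced by
  those of the identity. Hence \<open>A * C\<close> has the first \<open>k\<close> columns of the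
  identity and the last \<open>n\<close> columns of \<open>A\<close>, and both \<open>C\<close> and
  \<open>A * C\<close> are block triangular; comparing determinants gives the claim.\<close>

lemma jacobi_complementary_minor:
  fixes A B :: "'a::idom mat"
  assumes A: "A \<in> carrier_mat (k + n) (k + n)" and B: "B \<in> carrier_mat (k + n) (k + n)"
    and AB: "A * B = 1\<^sub>m (k + n)" and det: "Determinant.det A = 1"
  shows "Determinant.det (Matrix.mat n n (\<lambda>(i, j). A $$ (i + k, j + k)))
    = Determinant.det (Matrix.mat k k (\<lambda>(i, j). B $$ (i, j)))"
proof -
  define B1 where "B1 = Matrix.mat k k (\<lambda>(i, j). B $$ (i, j))"
  define B2 where "B2 = Matrix.mat n k (\<lambda>(i, j). B $$ (i + k, j))"
  define A1 where "A1 = Matrix.mat k n (\<lambda>(i, j). A $$ (i, j + k))"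
  define A2 where "A2 = Matrix.mat n n (\<lambda>(i, j). A $$ (i + k, j + k))"
  define C where "C = four_block_mat B1 (0\<^sub>m k n) B2 (1\<^sub>m n)"
  have carrier: "B1 \<in> carrier_mat k k" "B2 \<in> carrier_mat n k"
    "A1 \<in> carrier_mat k n" "A2 \<in> carrier_mat n n"
    by (simp_all add: B1_def B2_def A1_def A2_def)
  have C: "C \<in> carrier_mat (k + n) (k + n)"
    using carrier by (simp add: C_def)
  have "A * C = four_block_mat (1\<^sub>m k) A1 (0\<^sub>m n k) A2"
  proof (rule Matrix.eq_matI)
    fix i j
    assume "i < dim_row (four_block_mat (1\<^sub>m k) A1 (0\<^sub>m n k) A2)"
      "j < dim_col (four_block_mat (1\<^sub>m k) A1 (0\<^sub>m n k) A2)"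
    then have ij: "i < k + n" "j < k + n"
      using carrier by auto
    show "(A * C) $$ (i, j) = four_block_mat (1\<^sub>m k) A1 (0\<^sub>m n k) A2 $$ (i, j)"
    proof (cases "j < k")
      case True
      have "col C j = col B j"
        using True B C carrier by (intro Matrix.eq_vecI) (auto simp: C_def B1_def B2_def)
      then have "(A * C) $$ (i, j) = (A * B) $$ (i, j)"
        using ij A B C by simp
      then show ?thesis
        using True ij carrier by (auto simp: AB)
    next
      case False
      have "col C j = unit_vec (k + n) j"
        using False ij C carrier by (intro Matrix.eq_vecI) (auto simp: C_def)
      then have "(A * C) $$ (i, j) = A $$ (i, j)"
        using ij A C by simp
      then show ?thesis
        using False ij carrier by (auto simp: A1_def A2_def)
    qed
  qed (use A C carrier in auto)
  then have "Determinant.det A * Determinant.det C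
      = Determinant.det (four_block_mat (1\<^sub>m k) A1 (0\<^sub>m n k) A2)"
    by (simp flip: Determinant.det_mult[OF A C])
  then show ?thesis
    unfolding A2_def[symmetric] B1_def[symmetric]
    by (simp add: det C_def det_four_block_mat_upper_right_zero[OF carrier(1) refl carrier(2)]
      det_four_block_mat_lower_left_zero[OF _ carrier(3) refl carrier(4)])
qed

lemma det_pascal_gram:
  "Determinant.det (Matrix.mat n n (\<lambda>(i, j). pascal_gram b a i j)) = 1"
proof -
  have "Matrix.mat n n (\<lambda>(i, j). pascal_gram b a i j) = pascal_mat n b * (pascal_mat n a)\<^sup>T"
    by (rule Matrix.eq_matI)
      (simp_all add: pascal_mat_def scalar_prod_def pascal_gram_conv flip: lessThan_atLeast0)
  then show ?thesis
    by (simp add: Determinant.det_mult[of _ n] Determinant.det_transpose[of _ n] det_pascal_mat)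
qed

text \<open>The \<open>n\<close> by \<open>n\<close> determinant becomes one of size
  \<open>k\<close> in which \<open>n\<close> survives only as the length of a partial sum. The
  inverse of P(b) P(a)^T is P(-a)^T P(-b), whose entries sum over the row index of the Pascal
  matrices.\<close>

lemma det_pascal_gram_shifted:
  fixes a b :: "'a::idom"
  shows "Determinant.det (Matrix.mat n n (\<lambda>(i, j). pascal_gram b a (i + k) (j + k)))
    = Determinant.det (Matrix.mat k k (\<lambda>(i, j). \<Sum>m<n + k. pascal (- a) m i * pascal (- b) m j))"
proof -
  define N where "N = k + n"
  define A where "A = pascal_mat N b * (pascal_mat N a)\<^sup>T"
  define B where "B = (pascal_mat N (- a))\<^sup>T * pascal_mat N (- b)"
  have carrier: "A \<in> carrier_mat (k + n) (k + n)" "B \<in> carrier_mat (k + n) (k + n)"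
    by (simp_all add: A_def B_def N_def mult_carrier_mat[of _ "k + n" "k + n"])
  have "(pascal_mat N a)\<^sup>T * (pascal_mat N (- a))\<^sup>T = 1\<^sub>m N"
    by (simp add: pascal_mat_mult pascal_mat_0 flip: transpose_mult[of _ N N _ N])
  then have "A * B = 1\<^sub>m (k + n)"
    unfolding N_def[symmetric] A_def B_def
    by (smt (verit) assoc_mult_mat left_mult_one_mat mult_carrier_mat pascal_mat_0 pascal_mat_carrier
      pascal_mat_mult right_minus transpose_carrier_mat)
  moreover have "Determinant.det A = 1"
    by (simp add: A_def Determinant.det_mult[of _ N] Determinant.det_transpose[of _ N] det_pascal_mat)
  ultimately have "Determinant.det (Matrix.mat n n (\<lambda>(i, j). A $$ (i + k, j + k)))
    = Determinant.det (Matrix.mat k k (\<lambda>(i, j). B $$ (i, j)))"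
    using jacobi_complementary_minor carrier by blast
  moreover have "Matrix.mat n n (\<lambda>(i, j). A $$ (i + k, j + k))
      = Matrix.mat n n (\<lambda>(i, j). pascal_gram b a (i + k) (j + k))"
    by (rule Matrix.eq_matI)
      (simp_all add: A_def N_def pascal_mat_def scalar_prod_def pascal_gram_conv[of _ "k + n"]
        flip: lessThan_atLeast0)
  moreover have "Matrix.mat k k (\<lambda>(i, j). B $$ (i, j))
      = Matrix.mat k k (\<lambda>(i, j). \<Sum>m<n + k. pascal (- a) m i * pascal (- b) m j)"
    by (rule Matrix.eq_matI)
      (simp_all add: B_def N_def pascal_mat_def scalar_prod_def add.commute flip: lessThan_atLeast0)
  ultimately show ?thesis
    by simp
qed

section \<open>Powers of the denominator and passage to the limit\<close>

lemma sum_odd: "(\<Sum>i<n. Suc (i + i)) = n\<^sup>2"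
  by (induction n) (simp_all add: power2_eq_square)

text \<open>The power splits into the row factor with exponent \<open>i + k + 1\<close> and the
  column factor with exponent \<open>j + k\<close>; the exponents add up to the sum of
  \<open>2 * i + 1 + 2 * k\<close> over \<open>i < n\<close>.\<close>

lemma det_div_power:
  fixes d :: "'a::field"
  shows "Determinant.det (Matrix.mat n n (\<lambda>(i, j). A i j / d ^ Suc (i + k + (j + k))))
    = Determinant.det (Matrix.mat n n (\<lambda>(i, j). A i j)) / d ^ (n * (n + 2 * k))"
proof -
  have "Matrix.mat n n (\<lambda>(i, j). A i j / d ^ Suc (i + k + (j + k)))
      = Matrix.mat n n (\<lambda>(i, j). (1 / d ^ Suc (i + k)) * A i j * (1 / d ^ (j + k)))"
    by (rule Matrix.eq_matI) (auto simp: power_add)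
  then have "Determinant.det (Matrix.mat n n (\<lambda>(i, j). A i j / d ^ Suc (i + k + (j + k))))
      = (\<Prod>i<n. 1 / d ^ Suc (i + k) * (1 / d ^ (i + k))) * Determinant.det (Matrix.mat n n (\<lambda>(i, j). A i j))"
    by (simp only: det_scale prod.distrib)
  also have "(\<Prod>i<n. 1 / d ^ Suc (i + k) * (1 / d ^ (i + k))) = 1 / d ^ (\<Sum>i<n. Suc (i + i) + 2 * k)"
  proof -
    have "1 / d ^ Suc (i + k) * (1 / d ^ (i + k)) = 1 / d ^ (Suc (i + i) + 2 * k)" for i
      by (simp add: mult_2 power_add)
    then show ?thesis
      by (simp only: power_sum prod_dividef prod.neutral_const)
  qed
  also have "(\<Sum>i<n. Suc (i + i) + 2 * k) = n * (n + 2 * k)"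
    unfolding sum.distrib sum_odd by (simp add: power2_eq_square algebra_simps)
  finally show ?thesis
    by simp
qed

lemma tendsto_det:
  fixes A :: "'b \<Rightarrow> nat \<Rightarrow> nat \<Rightarrow> complex"
  assumes "\<And>i j. i < n \<Longrightarrow> j < n \<Longrightarrow> ((\<lambda>x. A x i j) \<longlongrightarrow> L i j) F"
  shows "((\<lambda>x. Determinant.det (Matrix.mat n n (\<lambda>(i, j). A x i j))) \<longlongrightarrow>
    Determinant.det (Matrix.mat n n (\<lambda>(i, j). L i j))) F"
  using permutes_in_image[of _ "{0..<n}"] assms unfolding det_leibniz
  by (auto intro!: tendsto_intros)

section \<open>Asymptotics\<close>

lemma sqcd_hilbert_series_tendsto:
  fixes t t' :: complex
  assumes t: "norm t < 1" and t': "norm t' < 1"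
  shows "(\<lambda>n. sqcd_hilbert_series (n + k) n t t' * (1 - t * t') ^ (n + k)\<^sup>2) \<longlonglongrightarrow> 1"
proof -
  define d where "d = 1 - t * t'"
  define K where "K n i j = (\<Sum>m<n + k. pascal (- t') m i * pascal (- t) m j)" for n i j
  have "norm (t' * t) < 1"
    unfolding norm_mult using mult_strict_mono[OF t' t] by simp
  then have nz: "d \<noteq> 0"
    by (auto simp: d_def mult.commute)
  have "sqcd_hilbert_series (n + k) n t t' * d ^ (n + k)\<^sup>2
      = Determinant.det (Matrix.mat k k (\<lambda>(i, j). K n i j)) * d ^ k\<^sup>2" for n
  proof -
    \<comment> \<open>The part \<open>n * (n + 2 * k)\<close> cancels the denominator from
      \<open>det_div_power\<close>; the part \<open>k\<^sup>2\<close> is left for the limiting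
      determinant.\<close>
    have "(n + k)\<^sup>2 = k\<^sup>2 + n * (n + 2 * k)"
      by (simp add: power2_eq_square algebra_simps)
    then show ?thesis
      unfolding sqcd_hilbert_series_eq_det[OF t t'] d_def[symmetric] det_div_power
        det_pascal_gram_shifted K_def
      using nz by (simp add: power_add)
  qed
  \<comment> \<open>The exponent is written with zeros so that \<open>det_div_power\<close> also
    applies to the limit, with shift 0 and size \<open>k\<close>.\<close>
  moreover have "(\<lambda>n. Determinant.det (Matrix.mat k k (\<lambda>(i, j). K n i j)))
      \<longlonglongrightarrow> Determinant.det (Matrix.mat k k (\<lambda>(i, j). pascal_gram (- t) (- t') i j / d ^ Suc (i + 0 + (j + 0))))"
  proof (rule tendsto_det)
    fix i j
    \<comment> \<open>Negating both parameters leaves their product unchanged, so the same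
      \<open>d\<close> appears.\<close>
    have "(\<lambda>m. pascal (- t') m i * pascal (- t) m j) sums
        (pascal_gram (- t) (- t') i j / d ^ Suc (i + 0 + (j + 0)))"
      using pascal_mult_sums[of "- t'" "- t" i j] t t' by (simp add: d_def mult.commute)
    then show "(\<lambda>n. K n i j) \<longlonglongrightarrow> pascal_gram (- t) (- t') i j / d ^ Suc (i + 0 + (j + 0))"
      unfolding sums_def K_def by (rule LIMSEQ_ignore_initial_segment)
  qed
  then have "(\<lambda>n. Determinant.det (Matrix.mat k k (\<lambda>(i, j). K n i j)) * d ^ k\<^sup>2)
      \<longlonglongrightarrow> 1 / d ^ k\<^sup>2 * d ^ k\<^sup>2"
    unfolding det_div_power det_pascal_gram
    by (intro tendsto_mult tendsto_const) (simp add: power2_eq_square)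
  ultimately show ?thesis
    using nz by (simp add: d_def)
qed

theorem mainTheorem11:
  fixes \<Delta> :: nat and t t' :: real
  assumes "0 \<le> t" "t < 1" "0 \<le> t'" "t' < 1"
  shows "(\<lambda>Nc. let Nf = Nc + 1 + \<Delta> in
            sqcd_hilbert_series Nf Nc (complex_of_real t) (complex_of_real t'))
         \<sim>[sequentially]
         (\<lambda>Nc. let Nf = Nc + 1 + \<Delta> in
            complex_of_real
              ((1 - (real (Nf choose \<Delta>))\<^sup>2 * (1 - t * t') ^ (2 * \<Delta>) * (t * t') ^ (Nc + 1))
               / (1 - t * t') ^ (Nf\<^sup>2)))"
proof -
  define q where "q = t * t'"
  \<comment> \<open>With this \<open>c\<close>, the correction term \<open>e n\<close> is, up to a
    constant factor, the square of \<open>pascal c (n + Suc \<Delta>) \<Delta>\<close>, whose power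
    of \<open>c\<close> is exactly \<open>n + 1\<close>. As a term of a summable sequence it tends
    to 0.\<close>
  define c where "c = sqrt q"
  define g where "g n = sqcd_hilbert_series (n + Suc \<Delta>) n (of_real t) (of_real t')" for n
  define e where "e n = (real ((n + Suc \<Delta>) choose \<Delta>))\<^sup>2 * (1 - q) ^ (2 * \<Delta>) * q ^ Suc n" for n
  have q: "0 \<le> q" "q < 1"
    using assms mult_strict_mono[of t 1 t' 1] by (simp_all add: q_def)
  then have c: "0 \<le> c" "c < 1" "c\<^sup>2 = q"
    by (simp_all add: c_def)
  have "(\<lambda>n. norm (pascal (complex_of_real c) (n + Suc \<Delta>) \<Delta>)) \<longlonglongrightarrow> 0"
    using c by (intro LIMSEQ_ignore_initial_segment summable_LIMSEQ_zero summable_norm_pascal) simp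
  then have "(\<lambda>n. (norm (pascal (complex_of_real c) (n + Suc \<Delta>) \<Delta>))\<^sup>2 * (1 - q) ^ (2 * \<Delta>))
      \<longlonglongrightarrow> 0\<^sup>2 * (1 - q) ^ (2 * \<Delta>)"
    by (intro tendsto_intros)
  moreover have "(norm (pascal (complex_of_real c) (n + Suc \<Delta>) \<Delta>))\<^sup>2 * (1 - q) ^ (2 * \<Delta>) = e n" for n
  proof -
    have "(c ^ Suc n)\<^sup>2 = q ^ Suc n"
      by (metis c(3) power_mult mult.commute)
    then show ?thesis
      using c(1) by (simp add: pascal_def norm_mult norm_power power_mult_distrib e_def mult_ac)
  qed
  ultimately have "e \<longlonglongrightarrow> 0"
    by simp
  then have "(\<lambda>n. complex_of_real (1 - e n)) \<longlonglongrightarrow> of_real (1 - 0)"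
    by (intro tendsto_intros)
  moreover have "(\<lambda>n. g n * (1 - of_real t * of_real t') ^ (n + Suc \<Delta>)\<^sup>2) \<longlonglongrightarrow> 1"
    unfolding g_def by (rule sqcd_hilbert_series_tendsto) (use assms in auto)
  \<comment> \<open>The numerator of the asserted asymptotics tends to 1, so dividing by it keeps
    the limit.\<close>
  ultimately have "(\<lambda>n. g n * (1 - of_real t * of_real t') ^ (n + Suc \<Delta>)\<^sup>2 / of_real (1 - e n)) \<longlonglongrightarrow> 1 / of_real (1 - 0)"
    by (intro tendsto_divide) auto
  also have "(\<lambda>n. g n * (1 - of_real t * of_real t') ^ (n + Suc \<Delta>)\<^sup>2 / of_real (1 - e n))
      = (\<lambda>n. g n / of_real ((1 - e n) / (1 - q) ^ (n + Suc \<Delta>)\<^sup>2))"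
    by (simp add: q_def)
  finally have "g \<sim>[sequentially] (\<lambda>n. of_real ((1 - e n) / (1 - q) ^ (n + Suc \<Delta>)\<^sup>2))"
    by (intro asymp_equivI') simp
  then show ?thesis
    by (simp add: g_def[abs_def] e_def q_def Let_def del: of_real_divide)
qed

end
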